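(* Let $V\ge 1$ be an integer and let $z^t, z^s\in\mathbb{R}^V$ be fixed (teacher and student logit) vectors that are centered, i.e. $\sum_{i=1}^V z_i^t=\sum_{i=1}^V z_i^s=0$. For a temperature $\tau\ge 1$ let $p^\tau=\mathrm{softmax}(z^t/\tau)$, $q^\tau=\mathrm{softmax}(z^s/\tau)$, $\mathcal{L}_{\mathrm{FKL}}=D_{\mathrm{KL}}(p^\tau\Vert q^\tau)$ and $\mathcal{L}_{\mathrm{RKL}}=D_{\mathrm{KL}}(q^\tau\Vert p^\tau)$. Then, for every $i\in\{1,\dots,V\}$, as $\tau\to\infty$, $$\nabla_{z_i^s}\mathcal{L}_{\mathrm{FKL}}=\frac{1}{V\tau^2}(z_i^s-z_i^t)+O(\tau^{-3})\quad\text{and}\quad \nabla_{z_i^s}\mathcal{L}_{\mathrm{RKL}}=\frac{1}{V\tau^2}(z_i^s-z_i^t)+O(\tau^{-3}).$$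
   Context: For $z\in\mathbb{R}^V$, $\mathrm{softmax}(z)$ is the probability vector with entries $\exp(z_i)/\sum_{j=1}^V\exp(z_j)$. For probability vectors $a,b$ with positive entries, $D_{\mathrm{KL}}(a\Vert b)=\sum_{i=1}^V a_i\log(a_i/b_i)$ (natural logarithm). $\nabla_{z_i^s}$ denotes the partial derivative with respect to the $i$-th coordinate $z_i^s$ of $z^s$, where $\mathcal{L}_{\mathrm{FKL}}$ and $\mathcal{L}_{\mathrm{RKL}}$ are regarded as functions of $z^s\in\mathbb{R}^V$ with $z^t$ and $\tau$ held fixed; the derivative is taken in all of $\mathbb{R}^V$ and then evaluated at the given centered $z^s$. The $O(\tau^{-3})$ terms are for $\tau\to\infty$ with $z^t,z^s,V$ fixed. *)

theory Defs
  imports "HOL-Analysis.Analysis" "HOL-Library.Landau_Symbols"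
begin

definition softmax :: "real ^ 'n \<Rightarrow> real ^ 'n" where
  "softmax z = (\<chi> i. exp (z $ i) / (\<Sum>j\<in>UNIV. exp (z $ j)))"

text \<open>Only meaningful for probability vectors with positive entries; softmax always yields such.\<close>

definition KL_div :: "real ^ 'n \<Rightarrow> real ^ 'n \<Rightarrow> real" where
  "KL_div a b = (\<Sum>i\<in>UNIV. a $ i * ln (a $ i / b $ i))"

text \<open>The student logits come last, so that \<open>FKL zt \<tau>\<close> and \<open>RKL zt \<tau>\<close> are the losses as functions
  of the student logits, with teacher logits and temperature held fixed.\<close>

definition FKL :: "real ^ 'n \<Rightarrow> real \<Rightarrow> real ^ 'n \<Rightarrow> real" where
  "FKL zt \<tau> zs = KL_div (softmax (zt /\<^sub>R \<tau>)) (softmax (zs /\<^sub>R \<tau>))"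

definition RKL :: "real ^ 'n \<Rightarrow> real \<Rightarrow> real ^ 'n \<Rightarrow> real" where
  "RKL zt \<tau> zs = KL_div (softmax (zs /\<^sub>R \<tau>)) (softmax (zt /\<^sub>R \<tau>))"

definition has_partial :: "(real ^ 'n \<Rightarrow> real) \<Rightarrow> 'n \<Rightarrow> real ^ 'n \<Rightarrow> bool" where
  "has_partial f i z \<longleftrightarrow> (\<lambda>h. f (z + h *\<^sub>R axis i 1)) field_differentiable (at 0)"

text \<open>The value is unspecified unless \<open>has_partial f i z\<close> holds.\<close>

definition partial :: "(real ^ 'n \<Rightarrow> real) \<Rightarrow> 'n \<Rightarrow> real ^ 'n \<Rightarrow> real" where
  "partial f i z = deriv (\<lambda>h. f (z + h *\<^sub>R axis i 1)) 0"

end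

theory Submission
  imports Defs "HOL-Real_Asymp.Real_Asymp"
begin

text \<open>
  With \<open>d = zs - zt\<close> the two gradients are \<open>(q\<^sub>i - p\<^sub>i) / \<tau>\<close> and
  \<open>q\<^sub>i (d\<^sub>i - \<Sum>\<^sub>j q\<^sub>j d\<^sub>j) / \<tau>\<^sup>2\<close>. For centered \<open>z\<close> the normalising sum of the softmax is
  \<open>V + O(\<tau>\<^sup>-\<^sup>2)\<close>, so each entry is \<open>1/V + z\<^sub>i/(V\<tau>) + O(\<tau>\<^sup>-\<^sup>2)\<close>. The forward claim follows
  directly; in the reverse case \<open>\<Sum>\<^sub>j q\<^sub>j d\<^sub>j = \<Sum>\<^sub>j (q\<^sub>j - 1/V) d\<^sub>j = O(\<tau>\<^sup>-\<^sup>1)\<close> as \<open>d\<close> is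
  centered.
\<close>

section \<open>Closed form of the divergence between softmax vectors\<close>

lemma sum_exp_pos: "(\<Sum>j\<in>UNIV. exp ((z :: real ^ 'n) $ j)) > 0"
  by (intro sum_pos) auto

lemma sum_softmax: "(\<Sum>j\<in>UNIV. softmax z $ j) = 1"
  using sum_exp_pos[of z] by (simp add: softmax_def flip: sum_divide_distrib)

lemma ln_softmax_divide:
  "ln (softmax a $ j / softmax b $ j) =
     a $ j - b $ j - ln (\<Sum>k\<in>UNIV. exp (a $ k)) + ln (\<Sum>k\<in>UNIV. exp (b $ k))"
  using sum_exp_pos[of a] sum_exp_pos[of b] by (simp add: softmax_def ln_div ln_mult)

text \<open>The log-ratio of two softmax entries is the difference of logits plus a constant
  \<open>c\<close> that does not depend on the index. As the weights sum to 1, \<open>c\<close>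
  leaves the sum unscaled. What remains is a weighted sum of logit differences and two log-sum-exp
  terms, all easy to differentiate.\<close>

lemma KL_div_softmax:
  "KL_div (softmax a) (softmax b) =
     (\<Sum>j\<in>UNIV. softmax a $ j * (a $ j - b $ j))
       - ln (\<Sum>k\<in>UNIV. exp (a $ k)) + ln (\<Sum>k\<in>UNIV. exp (b $ k))"
proof -
  define c where "c = ln (\<Sum>k\<in>UNIV. exp (b $ k)) - ln (\<Sum>k\<in>UNIV. exp (a $ k))"
  have "KL_div (softmax a) (softmax b) = (\<Sum>j\<in>UNIV. softmax a $ j * (a $ j - b $ j + c))"
    unfolding KL_div_def ln_softmax_divide c_def by (simp add: algebra_simps)
  also have "\<dots> = (\<Sum>j\<in>UNIV. softmax a $ j * (a $ j - b $ j)) + (\<Sum>j\<in>UNIV. softmax a $ j) * c"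
    by (simp add: distrib_left sum.distrib sum_distrib_right)
  finally show ?thesis
    by (simp add: sum_softmax c_def)
qed

section \<open>Partial derivatives of the losses\<close>

lemma has_field_derivative_scaled_component:
  "((\<lambda>h. ((z + h *\<^sub>R axis i 1) /\<^sub>R \<tau>) $ j) has_field_derivative of_bool (j = i) / \<tau>) (at h)"
  for z :: "real ^ 'n"
  \<comment> \<open>At \<open>\<tau> = 0\<close> the function is constantly 0 and the claimed
    derivative is a division by zero, hence also 0.\<close>
  by (auto intro!: derivative_eq_intros simp: axis_def divide_inverse)

lemma has_field_derivative_sum_exp:
  "((\<lambda>h. \<Sum>j\<in>UNIV. exp (((z + h *\<^sub>R axis i 1) /\<^sub>R \<tau>) $ j)) has_field_derivative
     exp ((z /\<^sub>R \<tau>) $ i) / \<tau>) (at 0)"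
  for z :: "real ^ 'n"
proof -
  have "((\<lambda>h. \<Sum>j\<in>UNIV. exp (((z + h *\<^sub>R axis i 1) /\<^sub>R \<tau>) $ j)) has_field_derivative
     (\<Sum>j\<in>UNIV. exp (((z + 0 *\<^sub>R axis i 1) /\<^sub>R \<tau>) $ j) * (of_bool (j = i) / \<tau>))) (at 0)"
    by (intro DERIV_sum DERIV_fun_exp has_field_derivative_scaled_component)
  \<comment> \<open>Only the summand at \<open>i\<close> survives; in \<open>if\<close> form the
    simplifier collapses the sum.\<close>
  also have "(\<Sum>j\<in>UNIV. exp (((z + 0 *\<^sub>R axis i 1) /\<^sub>R \<tau>) $ j) * (of_bool (j = i) / \<tau>))
      = (\<Sum>j\<in>UNIV. if j = i then exp ((z /\<^sub>R \<tau>) $ i) / \<tau> else 0)"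
    by (intro sum.cong) auto
  finally show ?thesis
    by simp
qed

text \<open>The chain rule divides the derivative of the sum by the sum itself, which turns the
  exponential at \<open>i\<close> into its softmax weight.\<close>

lemma has_field_derivative_ln_sum_exp:
  "((\<lambda>h. ln (\<Sum>j\<in>UNIV. exp (((z + h *\<^sub>R axis i 1) /\<^sub>R \<tau>) $ j))) has_field_derivative
     softmax (z /\<^sub>R \<tau>) $ i / \<tau>) (at 0)"
  for z :: "real ^ 'n"
  using DERIV_chain2[OF DERIV_ln_divide has_field_derivative_sum_exp[where z = z and i = i and \<tau> = \<tau>]]
    sum_exp_pos[of "z /\<^sub>R \<tau>"]
  by (simp add: softmax_def)

text \<open>The softmax Jacobian, from the quotient rule. It serves the reverse loss, where the
  student logits also enter the weights.\<close>

lemma has_field_derivative_softmax: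
  fixes z :: "real ^ 'n" and \<tau> :: real
  defines "q \<equiv> softmax (z /\<^sub>R \<tau>)"
  shows "((\<lambda>h. softmax ((z + h *\<^sub>R axis i 1) /\<^sub>R \<tau>) $ j) has_field_derivative
     q $ j * (of_bool (j = i) - q $ i) / \<tau>) (at 0)"
proof -
  define S where "S = (\<Sum>k\<in>UNIV. exp ((z /\<^sub>R \<tau>) $ k))"
  have S: "S > 0"
    unfolding S_def by (rule sum_exp_pos)
  have "((\<lambda>h. exp (((z + h *\<^sub>R axis i 1) /\<^sub>R \<tau>) $ j) /
           (\<Sum>k\<in>UNIV. exp (((z + h *\<^sub>R axis i 1) /\<^sub>R \<tau>) $ k))) has_field_derivative
         ((exp ((z /\<^sub>R \<tau>) $ j) * (of_bool (j = i) / \<tau>)) * S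
            - exp ((z /\<^sub>R \<tau>) $ j) * (exp ((z /\<^sub>R \<tau>) $ i) / \<tau>)) / (S * S)) (at 0)"
    using DERIV_divide[OF
        DERIV_fun_exp[OF has_field_derivative_scaled_component[where z = z and i = i and j = j]]
        has_field_derivative_sum_exp[where z = z and i = i and \<tau> = \<tau>]] S
    by (simp add: S_def)
  also have "((exp ((z /\<^sub>R \<tau>) $ j) * (of_bool (j = i) / \<tau>)) * S
            - exp ((z /\<^sub>R \<tau>) $ j) * (exp ((z /\<^sub>R \<tau>) $ i) / \<tau>)) / (S * S)
      = (exp ((z /\<^sub>R \<tau>) $ j) / S) * (of_bool (j = i) - exp ((z /\<^sub>R \<tau>) $ i) / S) / \<tau>"
    using S by (simp add: divide_inverse algebra_simps)
  finally show ?thesis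
    by (simp add: softmax_def q_def S_def)
qed

lemma has_field_derivative_FKL:
  fixes zt zs :: "real ^ 'n"
  shows "((\<lambda>h. FKL zt \<tau> (zs + h *\<^sub>R axis i 1)) has_field_derivative
     (softmax (zs /\<^sub>R \<tau>) $ i - softmax (zt /\<^sub>R \<tau>) $ i) / \<tau>) (at 0)"
proof -
  let ?p = "softmax (zt /\<^sub>R \<tau>)"
  \<comment> \<open>The weights and the first log-sum-exp belong to the teacher, so they are
    constant in \<open>h\<close>; the latter contributes the \<open>- 0\<close>.\<close>
  have "((\<lambda>h. FKL zt \<tau> (zs + h *\<^sub>R axis i 1)) has_field_derivative
      (\<Sum>j\<in>UNIV. ?p $ j * (0 - of_bool (j = i) / \<tau>)) - 0 + softmax (zs /\<^sub>R \<tau>) $ i / \<tau>) (at 0)"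
    unfolding FKL_def KL_div_softmax
    by (intro DERIV_add DERIV_diff DERIV_sum DERIV_cmult DERIV_const
        has_field_derivative_scaled_component has_field_derivative_ln_sum_exp)
  also have "(\<Sum>j\<in>UNIV. ?p $ j * (0 - of_bool (j = i) / \<tau>))
      = (\<Sum>j\<in>UNIV. if j = i then - ?p $ i / \<tau> else 0)"
    by (intro sum.cong) auto
  finally show ?thesis
    by (simp add: diff_divide_distrib)
qed

lemma has_field_derivative_RKL:
  fixes zt zs :: "real ^ 'n"
  defines "q \<equiv> \<lambda>\<tau>. softmax (zs /\<^sub>R \<tau>)"
  shows "((\<lambda>h. RKL zt \<tau> (zs + h *\<^sub>R axis i 1)) has_field_derivative
     q \<tau> $ i * (zs $ i - zt $ i - (\<Sum>j\<in>UNIV. q \<tau> $ j * (zs $ j - zt $ j))) / \<tau>\<^sup>2) (at 0)"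
proof -
  let ?q = "q \<tau>" and ?d = "\<lambda>j. zs $ j - zt $ j"
  \<comment> \<open>Product rule on weight times logit difference. Differentiating the logit
    difference gives \<open>?q $ i / \<tau>\<close> in total, which cancels against the derivative
    of the student's log-sum-exp.\<close>
  have "((\<lambda>h. RKL zt \<tau> (zs + h *\<^sub>R axis i 1)) has_field_derivative
      (\<Sum>j\<in>UNIV. (?q $ j * (of_bool (j = i) - ?q $ i) / \<tau>)
             * (((zs + 0 *\<^sub>R axis i 1) /\<^sub>R \<tau>) $ j - (zt /\<^sub>R \<tau>) $ j)
          + (of_bool (j = i) / \<tau> - 0) * softmax ((zs + 0 *\<^sub>R axis i 1) /\<^sub>R \<tau>) $ j)
        - ?q $ i / \<tau> + 0) (at 0)"
    unfolding RKL_def KL_div_softmax q_def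
    by (intro DERIV_add DERIV_diff DERIV_sum DERIV_mult DERIV_const
        has_field_derivative_scaled_component has_field_derivative_ln_sum_exp
        has_field_derivative_softmax)
  also have "(\<Sum>j\<in>UNIV. (?q $ j * (of_bool (j = i) - ?q $ i) / \<tau>)
             * (((zs + 0 *\<^sub>R axis i 1) /\<^sub>R \<tau>) $ j - (zt /\<^sub>R \<tau>) $ j)
          + (of_bool (j = i) / \<tau> - 0) * softmax ((zs + 0 *\<^sub>R axis i 1) /\<^sub>R \<tau>) $ j)
      = (\<Sum>j\<in>UNIV. (if j = i then ?q $ i * ?d i / \<tau>\<^sup>2 + ?q $ i / \<tau> else 0)
          - ?q $ i / \<tau>\<^sup>2 * (?q $ j * ?d j))"
    by (intro sum.cong) (auto simp: q_def power2_eq_square divide_inverse algebra_simps)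
  also have "\<dots> = ?q $ i * ?d i / \<tau>\<^sup>2 + ?q $ i / \<tau> - ?q $ i / \<tau>\<^sup>2 * (\<Sum>j\<in>UNIV. ?q $ j * ?d j)"
    by (simp only: sum_subtractf sum_distrib_left) simp
  also have "\<dots> - ?q $ i / \<tau> + 0
      = ?q $ i * (?d i - (\<Sum>j\<in>UNIV. ?q $ j * ?d j)) / \<tau>\<^sup>2"
    by (simp only: right_diff_distrib diff_divide_distrib) simp
  finally show ?thesis .
qed

section \<open>Expansion of softmax at high temperature\<close>

lemma exp_scaled_expansion:
  "(\<lambda>\<tau>. exp (inverse \<tau> * c) - 1 - c / \<tau>) \<in> O[at_top](\<lambda>\<tau>. 1 / \<tau>\<^sup>2)" for c :: real
  by real_asymp

text \<open>Summing the first-order Taylor expansions of the exponentials, the linear terms add up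
  to 0 because \<open>z\<close> is centered.\<close>

lemma sum_exp_scaled_expansion:
  fixes z :: "real ^ 'n"
  assumes "(\<Sum>j\<in>UNIV. z $ j) = 0"
  shows "(\<lambda>\<tau>. (\<Sum>j\<in>UNIV. exp ((z /\<^sub>R \<tau>) $ j)) - real CARD('n)) \<in> O[at_top](\<lambda>\<tau>. 1 / \<tau>\<^sup>2)"
proof -
  have "(\<lambda>\<tau>. \<Sum>j\<in>UNIV. exp (inverse \<tau> * z $ j) - 1 - z $ j / \<tau>) \<in> O[at_top](\<lambda>\<tau>. 1 / \<tau>\<^sup>2)"
    by (intro big_sum_in_bigo exp_scaled_expansion)
  also have "(\<lambda>\<tau>. \<Sum>j\<in>UNIV. exp (inverse \<tau> * z $ j) - 1 - z $ j / \<tau>) =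
      (\<lambda>\<tau>. (\<Sum>j\<in>UNIV. exp ((z /\<^sub>R \<tau>) $ j)) - real CARD('n))"
    by (simp add: sum_subtractf assms flip: sum_divide_distrib)
  finally show ?thesis .
qed

lemma softmax_expansion:
  fixes z :: "real ^ 'n"
  assumes "(\<Sum>j\<in>UNIV. z $ j) = 0"
  shows "(\<lambda>\<tau>. softmax (z /\<^sub>R \<tau>) $ i - 1 / real CARD('n) - z $ i / (real CARD('n) * \<tau>))
           \<in> O[at_top](\<lambda>\<tau>. 1 / \<tau>\<^sup>2)"
proof -
  define V where "V = real CARD('n)"
  define S where "S = (\<lambda>\<tau>. \<Sum>j\<in>UNIV. exp ((z /\<^sub>R \<tau>) $ j))"
  define E where "E = (\<lambda>\<tau>. exp (inverse \<tau> * z $ i))"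
  have V: "V > 0" by (simp add: V_def)
  have S: "S \<tau> > 0" for \<tau>
    unfolding S_def by (rule sum_exp_pos)
  have "((\<lambda>\<tau>. \<Sum>j\<in>UNIV. exp (inverse \<tau> * z $ j)) \<longlongrightarrow> (\<Sum>j\<in>(UNIV :: 'n set). 1)) at_top"
    by (intro tendsto_sum) real_asymp
  then have "(S \<longlongrightarrow> V) at_top"
    by (simp add: S_def V_def)
  \<comment> \<open>A finite limit bounds the reciprocal of the common denominator used
    below.\<close>
  then have "((\<lambda>\<tau>. 1 / (V * S \<tau>)) \<longlongrightarrow> 1 / (V * V)) at_top"
    using V by (intro tendsto_intros) auto
  then have inv: "(\<lambda>\<tau>. 1 / (V * S \<tau>)) \<in> O[at_top](\<lambda>_. 1)"
    by (intro bigoI_tendsto[where c = "1 / (V * V)"]) auto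
  have "(\<lambda>\<tau>. 1 + z $ i / \<tau>) \<in> O[at_top](\<lambda>_. 1)"
    by real_asymp
  from landau_o.big.mult[OF sum_exp_scaled_expansion[OF assms] this]
  have "(\<lambda>\<tau>. (S \<tau> - V) * (1 + z $ i / \<tau>)) \<in> O[at_top](\<lambda>\<tau>. 1 / \<tau>\<^sup>2)"
    by (simp add: S_def V_def)
  moreover have "(\<lambda>\<tau>. V * (E \<tau> - 1 - z $ i / \<tau>)) \<in> O[at_top](\<lambda>\<tau>. 1 / \<tau>\<^sup>2)"
    using exp_scaled_expansion[of "z $ i"] by (simp add: E_def)
  \<comment> \<open>This is the numerator of
    \<open>E \<tau> / S \<tau> - 1 / V - z $ i / (V * \<tau>)\<close> over
    \<open>V * S \<tau>\<close>, arranged so that each summand contains one of the two known errors,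
    in \<open>E\<close> or in \<open>S\<close>.\<close>
  ultimately have "(\<lambda>\<tau>. V * (E \<tau> - 1 - z $ i / \<tau>) - (S \<tau> - V) * (1 + z $ i / \<tau>))
      \<in> O[at_top](\<lambda>\<tau>. 1 / \<tau>\<^sup>2)"
    by (rule sum_in_bigo(2)[rotated])
  from landau_o.big.mult[OF this inv]
  have "(\<lambda>\<tau>. (V * (E \<tau> - 1 - z $ i / \<tau>) - (S \<tau> - V) * (1 + z $ i / \<tau>)) * (1 / (V * S \<tau>)))
      \<in> O[at_top](\<lambda>\<tau>. 1 / \<tau>\<^sup>2)"
    by simp
  also have "?this \<longleftrightarrow>
      (\<lambda>\<tau>. E \<tau> / S \<tau> - 1 / V - z $ i / (V * \<tau>)) \<in> O[at_top](\<lambda>\<tau>. 1 / \<tau>\<^sup>2)"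
  proof (intro landau_o.big.in_cong eventually_mono[OF eventually_gt_at_top[of 0]])
    fix \<tau> :: real assume "\<tau> > 0"
    then show "(V * (E \<tau> - 1 - z $ i / \<tau>) - (S \<tau> - V) * (1 + z $ i / \<tau>)) * (1 / (V * S \<tau>))
        = E \<tau> / S \<tau> - 1 / V - z $ i / (V * \<tau>)"
      using V S[of \<tau>] by (simp add: field_simps)
  qed
  finally show ?thesis
    by (simp add: softmax_def E_def S_def V_def)
qed

lemma softmax_minus_uniform:
  fixes z :: "real ^ 'n"
  assumes "(\<Sum>j\<in>UNIV. z $ j) = 0"
  shows "(\<lambda>\<tau>. softmax (z /\<^sub>R \<tau>) $ i - 1 / real CARD('n)) \<in> O[at_top](\<lambda>\<tau>. 1 / \<tau>)"
proof -
  have "(\<lambda>\<tau>. softmax (z /\<^sub>R \<tau>) $ i - 1 / real CARD('n) - z $ i / (real CARD('n) * \<tau>))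
      \<in> O[at_top](\<lambda>\<tau>. 1 / \<tau>)"
    by (rule landau_o.big_trans[OF softmax_expansion[OF assms]]) real_asymp
  moreover have "(\<lambda>\<tau>. z $ i / (real CARD('n) * \<tau>)) \<in> O[at_top](\<lambda>\<tau>. 1 / \<tau>)"
    by real_asymp
  ultimately show ?thesis
    using sum_in_bigo(1) by fastforce
qed

section \<open>Expansion of the two gradients\<close>

lemma partial_FKL_expansion:
  fixes zt zs :: "real ^ 'n"
  assumes "(\<Sum>j\<in>UNIV. zt $ j) = 0" and "(\<Sum>j\<in>UNIV. zs $ j) = 0"
  shows "(\<lambda>\<tau>. partial (FKL zt \<tau>) i zs - 1 / (real CARD('n) * \<tau>^2) * (zs $ i - zt $ i))
        \<in> O[at_top](\<lambda>\<tau>. 1 / \<tau>^3)"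
proof -
  define r where "r = (\<lambda>z :: real ^ 'n. \<lambda>\<tau>.
    softmax (z /\<^sub>R \<tau>) $ i - 1 / real CARD('n) - z $ i / (real CARD('n) * \<tau>))"
  \<comment> \<open>In the difference the terms \<open>1 / V\<close> cancel and the linear terms
    form the main term; the prefactor \<open>1 / \<tau>\<close> of the gradient supplies the third
    order.\<close>
  have "(\<lambda>\<tau>. r zs \<tau> - r zt \<tau>) \<in> O[at_top](\<lambda>\<tau>. 1 / \<tau>\<^sup>2)"
    unfolding r_def using assms by (intro sum_in_bigo softmax_expansion)
  then have "(\<lambda>\<tau>. (1 / \<tau>) * (r zs \<tau> - r zt \<tau>)) \<in> O[at_top](\<lambda>\<tau>. (1 / \<tau>) * (1 / \<tau>\<^sup>2))"
    by (intro landau_o.big.mult) auto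
  also have "(\<lambda>\<tau>. (1 / \<tau>) * (1 / \<tau>\<^sup>2)) = (\<lambda>\<tau>::real. 1 / \<tau>^3)"
    by (simp add: power2_eq_square power3_eq_cube mult.assoc)
  also have "(\<lambda>\<tau>. (1 / \<tau>) * (r zs \<tau> - r zt \<tau>)) =
      (\<lambda>\<tau>. partial (FKL zt \<tau>) i zs - 1 / (real CARD('n) * \<tau>^2) * (zs $ i - zt $ i))"
    unfolding partial_def DERIV_imp_deriv[OF has_field_derivative_FKL] r_def
    by (simp add: fun_eq_iff power2_eq_square divide_inverse algebra_simps)
  finally show ?thesis .
qed

lemma partial_RKL_expansion:
  fixes zt zs :: "real ^ 'n"
  assumes "(\<Sum>j\<in>UNIV. zt $ j) = 0" and "(\<Sum>j\<in>UNIV. zs $ j) = 0"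
  shows "(\<lambda>\<tau>. partial (RKL zt \<tau>) i zs - 1 / (real CARD('n) * \<tau>^2) * (zs $ i - zt $ i))
        \<in> O[at_top](\<lambda>\<tau>. 1 / \<tau>^3)"
proof -
  define V where "V = real CARD('n)"
  define q where "q = (\<lambda>\<tau> j. softmax (zs /\<^sub>R \<tau>) $ j)"
  define d where "d = (\<lambda>j. zs $ j - zt $ j)"
  have rate: "(\<lambda>\<tau>. q \<tau> j - 1 / V) \<in> O[at_top](\<lambda>\<tau>. 1 / \<tau>)" for j
    unfolding q_def V_def by (rule softmax_minus_uniform[OF assms(2)])
  have "(\<lambda>\<tau>. q \<tau> i - 1 / V) \<in> O[at_top](\<lambda>_. 1)"
    by (rule landau_o.big_trans[OF rate]) real_asymp
  then have q_bounded: "(\<lambda>\<tau>. q \<tau> i) \<in> O[at_top](\<lambda>_. 1)"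
    using sum_in_bigo(1)[of "\<lambda>\<tau>. q \<tau> i - 1 / V" at_top "\<lambda>_. 1" "\<lambda>_. 1 / V"] by simp
  have scaled: "(\<lambda>\<tau>. (q \<tau> j - 1 / V) * d j) \<in> O[at_top](\<lambda>\<tau>. 1 / \<tau>)" for j
    using landau_o.big.mult[OF rate[of j], of "\<lambda>_. d j" "\<lambda>_. 1"] by simp
  then have "(\<lambda>\<tau>. \<Sum>j\<in>UNIV. (q \<tau> j - 1 / V) * d j) \<in> O[at_top](\<lambda>\<tau>. 1 / \<tau>)"
    by (intro big_sum_in_bigo)
  moreover have "(\<Sum>j\<in>UNIV. d j) = 0"
    by (simp add: d_def sum_subtractf assms)
  \<comment> \<open>Subtracting the uniform weight changes nothing as \<open>d\<close> sums to 0, so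
    the weighted mean of \<open>d\<close> inherits the rate of
    \<open>q \<tau> j - 1 / V\<close>.\<close>
  then have "(\<Sum>j\<in>UNIV. (q \<tau> j - 1 / V) * d j) = (\<Sum>j\<in>UNIV. q \<tau> j * d j)" for \<tau>
    by (simp add: left_diff_distrib sum_subtractf flip: sum_divide_distrib)
  ultimately have mean: "(\<lambda>\<tau>. \<Sum>j\<in>UNIV. q \<tau> j * d j) \<in> O[at_top](\<lambda>\<tau>. 1 / \<tau>)"
    by simp
  \<comment> \<open>This is \<open>q \<tau> i * (d i - m)\<close>, with \<open>m\<close> the
    weighted mean, minus its limit \<open>d i / V\<close>.\<close>
  have "(\<lambda>\<tau>. (q \<tau> i - 1 / V) * d i - q \<tau> i * (\<Sum>j\<in>UNIV. q \<tau> j * d j)) \<in> O[at_top](\<lambda>\<tau>. 1 / \<tau>)"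
    using landau_o.big.mult[OF q_bounded mean] by (intro sum_in_bigo scaled) simp
  then have "(\<lambda>\<tau>. (1 / \<tau>\<^sup>2) * ((q \<tau> i - 1 / V) * d i - q \<tau> i * (\<Sum>j\<in>UNIV. q \<tau> j * d j)))
      \<in> O[at_top](\<lambda>\<tau>. (1 / \<tau>\<^sup>2) * (1 / \<tau>))"
    by (intro landau_o.big.mult) auto
  also have "(\<lambda>\<tau>. (1 / \<tau>\<^sup>2) * (1 / \<tau>)) = (\<lambda>\<tau>::real. 1 / \<tau>^3)"
    by (simp add: power2_eq_square power3_eq_cube mult.assoc)
  also have "(\<lambda>\<tau>. (1 / \<tau>\<^sup>2) * ((q \<tau> i - 1 / V) * d i - q \<tau> i * (\<Sum>j\<in>UNIV. q \<tau> j * d j))) =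
      (\<lambda>\<tau>. partial (RKL zt \<tau>) i zs - 1 / (real CARD('n) * \<tau>^2) * (zs $ i - zt $ i))"
  proof
    fix \<tau>
    have "(1 / \<tau>\<^sup>2) * ((q \<tau> i - 1 / V) * d i - q \<tau> i * m) =
        q \<tau> i * (d i - m) / \<tau>\<^sup>2 - 1 / (V * \<tau>\<^sup>2) * d i" for m
      by (simp add: divide_inverse algebra_simps)
    then show "(1 / \<tau>\<^sup>2) * ((q \<tau> i - 1 / V) * d i - q \<tau> i * (\<Sum>j\<in>UNIV. q \<tau> j * d j)) =
        partial (RKL zt \<tau>) i zs - 1 / (real CARD('n) * \<tau>^2) * (zs $ i - zt $ i)"
      unfolding partial_def DERIV_imp_deriv[OF has_field_derivative_RKL] q_def d_def V_def .
  qed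
  finally show ?thesis .
qed

theorem proposition2p1:
  fixes zt zs :: "real ^ 'n" and i :: 'n
  assumes "(\<Sum>j\<in>UNIV. zt $ j) = 0" and "(\<Sum>j\<in>UNIV. zs $ j) = 0"
  shows "(\<forall>\<tau>\<ge>1. has_partial (FKL zt \<tau>) i zs \<and> has_partial (RKL zt \<tau>) i zs)
    \<and> (\<lambda>\<tau>. partial (FKL zt \<tau>) i zs - 1 / (real CARD('n) * \<tau>^2) * (zs $ i - zt $ i))
        \<in> O[at_top](\<lambda>\<tau>. 1 / \<tau>^3)
    \<and> (\<lambda>\<tau>. partial (RKL zt \<tau>) i zs - 1 / (real CARD('n) * \<tau>^2) * (zs $ i - zt $ i))
        \<in> O[at_top](\<lambda>\<tau>. 1 / \<tau>^3)"
  \<comment> \<open>The explicit derivatives witness differentiability, so \<open>partial\<close>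
    denotes a genuine derivative in the two expansions.\<close>
  using has_field_derivative_FKL has_field_derivative_RKL
    partial_FKL_expansion[OF assms] partial_RKL_expansion[OF assms]
  unfolding has_partial_def field_differentiable_def by blast

end
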